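(* Let $d\ge 1$, let $V:\mathbb{R}^d\to(0,\infty)$ be a differentiable function such that $V^{-d}$ is a probability density on $\mathbb{R}^d$, and let $\mu$ be the probability measure with density $V^{-d}$. Assume that there is a constant $A>0$ such that $$|\nabla \log V(x)|\le \frac{A}{1+|x|}\qquad \text{for all } x\in\mathbb{R}^d.$$ Let $\nu$ be a Borel probability measure on $\mathbb{R}^d$ which is centered (that is, $\int z\,d\nu(z)=0$) and $\sigma^2$-subgaussian for some $\sigma>0$. Then the Brenier map $T$ from $\mu$ onto $\nu$ satisfies, for all $x$, $$|T(x)|\le \sqrt{d}\,\sigma\left(3+3\sqrt{2A\log 2+5A-d^{-1}\log\omega_d+\log V(0)+2A\log(1+|x|)}\right),$$ where $\omega_d$ is the volume of the unit ball of $\mathbb{R}^d$.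
   Context: $|\cdot|$ is the Euclidean norm. A probability measure $\nu$ on $\mathbb{R}^d$ is $\sigma^2$-subgaussian if for every $1$-Lipschitz function $f:\mathbb{R}^d\to\mathbb{R}$ with $\int f\,d\nu=0$ and every $\lambda\in\mathbb{R}$ one has $\int \exp(\lambda f)\,d\nu\le \exp(\sigma^2\lambda^2/2)$. Brenier map: for $\mu$ absolutely continuous with respect to Lebesgue measure and $\nu$ any Borel probability measure on $\mathbb{R}^d$, there is a convex function $\phi$ such that $T=\nabla\phi$ pushes $\mu$ forward to $\nu$, and $T$ is unique of this form up to $\mu$-null sets (Brenier–McCann theorem). This $T$ is the Brenier map. Pointwise statements about $T(x)$ are understood at the points $x$ where $\phi$ is differentiable (in particular they hold for $\mu$-almost every $x$). *)

theory Defs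
  imports "HOL-Analysis.Analysis" "HOL-Probability.Probability"
begin

text \<open>The gradient as a function; it is meaningful exactly at the points of differentiability,
  see \<open>gderiv_grad_iff\<close> below.\<close>

definition grad :: "('a::euclidean_space \<Rightarrow> real) \<Rightarrow> 'a \<Rightarrow> 'a"
  where "grad f x = (THE D. GDERIV f x :> D)"

lemma grad_eqI:
  assumes "GDERIV f x :> D"
  shows "grad f x = D"
  unfolding grad_def
proof (rule the_equality)
  fix D' assume "GDERIV f x :> D'"
  with assms have "(\<lambda>h. h \<bullet> D') = (\<lambda>h. h \<bullet> D)"
    unfolding gderiv_def by (rule has_derivative_unique[rotated])
  then have "h \<bullet> D' = h \<bullet> D" for h
    by metis
  then show "D' = D"
    by (metis vector_eq_rdot inner_commute)
qed (fact assms)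

lemma gderiv_grad_iff: "GDERIV f x :> grad f x \<longleftrightarrow> f differentiable at x"
proof
  assume "f differentiable at x"
  then obtain f' where f': "(f has_derivative f') (at x)"
    by (auto simp: differentiable_def)
  then interpret linear f'
    by (rule has_derivative_linear)
  define D where "D = (\<Sum>b\<in>Basis. f' b *\<^sub>R b)"
  have "f' h = h \<bullet> D" for h
  proof -
    have "f' h = f' (\<Sum>b\<in>Basis. (h \<bullet> b) *\<^sub>R b)"
      by (simp add: euclidean_representation)
    also have "\<dots> = h \<bullet> D"
      by (simp add: sum scaleR D_def inner_sum_right mult.commute)
    finally show ?thesis .
  qed
  then have "f' = (\<lambda>h. h \<bullet> D)" by blast
  with f' have "GDERIV f x :> D"
    by (simp add: gderiv_def)
  then show "GDERIV f x :> grad f x"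
    using grad_eqI by metis
qed (auto simp: gderiv_def differentiable_def)

text \<open>The second argument is the variance proxy \<open>\<sigma>\<^sup>2\<close>. Integrability of \<open>f\<close> is required
  explicitly because the Bochner integral of a non-integrable function is \<open>0\<close>; the exponential
  moment is a nonnegative integral for the same reason, so its finiteness is part of the claim.\<close>

definition subgaussian :: "'a::euclidean_space measure \<Rightarrow> real \<Rightarrow> bool"
  where "subgaussian \<nu> s \<longleftrightarrow>
    (\<forall>f :: 'a \<Rightarrow> real. 1-lipschitz_on UNIV f \<and> integrable \<nu> f \<and> (\<integral>x. f x \<partial>\<nu>) = 0 \<longrightarrow>
      (\<forall>l::real. (\<integral>\<^sup>+x. ennreal (exp (l * f x)) \<partial>\<nu>) \<le> ennreal (exp (s * l\<^sup>2 / 2))))"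

text \<open>\<open>T\<close> is the Brenier map from \<open>\<mu>\<close> to \<open>\<nu>\<close> with convex potential \<open>\<phi>\<close>. For general \<open>\<mu>\<close> the
  potential may take the value \<open>+\<infinity>\<close>; such a function is represented by its effective domain \<open>S\<close>
  together with a real-valued function \<open>\<phi>\<close>, convex on \<open>S\<close> and irrelevant outside it (a finite
  potential is the case \<open>S = UNIV\<close>). The potential is differentiable only at points of
  \<open>interior S\<close>. There \<open>T\<close> has to equal the gradient; on the remaining \<open>\<mu>\<close>-null set the values
  of \<open>T\<close> are unconstrained.\<close>

definition brenier_map ::
    "'a::euclidean_space measure \<Rightarrow> 'a measure \<Rightarrow> 'a set \<Rightarrow> ('a \<Rightarrow> real) \<Rightarrow> ('a \<Rightarrow> 'a) \<Rightarrow> bool"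
  where "brenier_map \<mu> \<nu> S \<phi> T \<longleftrightarrow>
    convex_on S \<phi> \<and>
    (AE x in \<mu>. x \<in> interior S \<and> \<phi> differentiable at x) \<and>
    (\<forall>x\<in>interior S. \<phi> differentiable at x \<longrightarrow> T x = grad \<phi> x) \<and>
    T \<in> borel_measurable \<mu> \<and>
    distr \<mu> borel T = \<nu>"

end

theory Submission
  imports Defs
begin

text \<open>The idea: by monotonicity of the gradient of a convex function, \<open>\<bar>T\<bar> \<ge> 4/5 \<bar>T x\<bar>\<close>
  throughout the cone with apex \<open>x\<close>, axis \<open>T x\<close> and aperture \<open>cos \<theta> \<ge> 4/5\<close>. This cone contains a
  ball of radius \<open>r = 1 + \<bar>x\<bar>\<close> centred at distance \<open>5/3 r\<close> from \<open>x\<close>. Since \<open>V\<close> grows at most like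
  \<open>\<bar>y\<bar>\<^sup>A\<close>, the \<open>\<mu>\<close>-mass of the ball is bounded below by a power of \<open>r\<close>, whereas it is at most the
  \<open>\<nu>\<close>-mass of the complement of a ball of radius \<open>4/5 \<bar>T x\<bar>\<close>, which is bounded above by a Gaussian tail.\<close>

section \<open>Gradients of convex functions\<close>

lemma convex_on_imp_above_gderiv:
  fixes f :: "'a::real_inner \<Rightarrow> real"
  assumes f: "convex_on S f" and x: "x \<in> S" and y: "y \<in> S" and D: "GDERIV f x :> D"
  shows "(y - x) \<bullet> D \<le> f y - f x"
proof -
  \<comment> \<open>Along the segment, convexity bounds the difference quotient of \<open>g\<close>
    on (0,1) by \<open>f y - f x\<close>; its limit at 0 from the right is the directional
    derivative.\<close>
  define g where "g t = f (x + t *\<^sub>R (y - x))" for t :: real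
  have "(f has_derivative (\<lambda>h. h \<bullet> D)) (at (x + 0 *\<^sub>R (y - x)))"
    using D by (simp add: gderiv_def)
  then have "(g has_derivative (\<lambda>t. (t *\<^sub>R (y - x)) \<bullet> D)) (at 0)"
    unfolding g_def by (rule has_derivative_compose[rotated]) (auto intro!: derivative_eq_intros)
  then have "DERIV g 0 :> (y - x) \<bullet> D"
    by (simp add: has_field_derivative_def mult.commute[of _ "(y - x) \<bullet> D"])
  then have "((\<lambda>t. (g t - g 0) / (t - 0)) \<longlongrightarrow> (y - x) \<bullet> D) (at_right 0)"
    unfolding has_field_derivative_iff by (rule filterlim_mono) (auto intro: at_le)
  moreover have "\<forall>\<^sub>F t in at_right 0. t \<in> {0<..<1::real}"
    by (rule eventually_at_right_real) simp
  then have "\<forall>\<^sub>F t in at_right 0. (g t - g 0) / (t - 0) \<le> f y - f x"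
  proof eventually_elim
    case (elim t)
    have "f ((1 - t) *\<^sub>R x + t *\<^sub>R y) \<le> (1 - t) * f x + t * f y"
      using f x y elim by (intro convex_onD) auto
    moreover have "(1 - t) *\<^sub>R x + t *\<^sub>R y = x + t *\<^sub>R (y - x)"
      by (simp add: algebra_simps)
    ultimately show ?case
      using elim by (simp add: g_def field_simps)
  qed
  ultimately show ?thesis
    by (rule tendsto_upperbound) simp
qed

text \<open>The tangent inequalities based at \<open>x\<close> and at \<open>y\<close> enclose
  \<open>f y - f x\<close> between the two sides.\<close>

lemma convex_on_gderiv_monotone:
  fixes f :: "'a::real_inner \<Rightarrow> real"
  assumes "convex_on S f" "x \<in> S" "y \<in> S" "GDERIV f x :> D" "GDERIV f y :> E"
  shows "(y - x) \<bullet> D \<le> (y - x) \<bullet> E"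
  using convex_on_imp_above_gderiv[of S f x y D] convex_on_imp_above_gderiv[of S f y x E] assms
  by (simp add: inner_diff_left)

section \<open>Growth of \<open>V\<close> and geometry of the cone\<close>

text \<open>Along the ray to \<open>x\<close>, the derivative of
  \<open>A * ln (1 + t * norm x)\<close> dominates that of \<open>f\<close>, so their difference
  \<open>h\<close> is nondecreasing. Comparing derivatives instead of integrating them avoids any
  regularity of the gradient.\<close>

lemma grad_log_growth:
  fixes f :: "'a::euclidean_space \<Rightarrow> real"
  assumes f: "\<And>x. f differentiable at x"
    and bound: "\<And>x. norm (grad f x) \<le> A / (1 + norm x)"
  shows "f x \<le> f 0 + A * ln (1 + norm x)"
proof -
  define h where "h t = A * ln (1 + t * norm x) - f (t *\<^sub>R x)" for t :: real
  have "h 0 \<le> h 1"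
  proof (rule DERIV_nonneg_imp_nondecreasing[where f = h])
    fix t :: real assume t: "0 \<le> t" "t \<le> 1"
    have pos: "1 + t * norm x > 0"
      using t by (simp add: add_pos_nonneg)
    have "(f has_derivative (\<lambda>h. h \<bullet> grad f (t *\<^sub>R x))) (at (t *\<^sub>R x))"
      using f gderiv_grad_iff unfolding gderiv_def by blast
    then have "((\<lambda>s. f (s *\<^sub>R x)) has_derivative (\<lambda>s. (s *\<^sub>R x) \<bullet> grad f (t *\<^sub>R x))) (at t)"
      by (rule has_derivative_compose[rotated]) (auto intro!: derivative_eq_intros)
    then have "((\<lambda>s. f (s *\<^sub>R x)) has_real_derivative x \<bullet> grad f (t *\<^sub>R x)) (at t)"
      by (simp add: has_field_derivative_def mult.commute[of _ "x \<bullet> _"])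
    then have "DERIV h t :> A * norm x / (1 + t * norm x) - x \<bullet> grad f (t *\<^sub>R x)"
      unfolding h_def using pos by (auto intro!: derivative_eq_intros)
    moreover have "x \<bullet> grad f (t *\<^sub>R x) \<le> norm x * (A / (1 + t * norm x))"
      using norm_cauchy_schwarz[of x "grad f (t *\<^sub>R x)"]
        mult_left_mono[OF bound[of "t *\<^sub>R x"], of "norm x"] t by simp
    ultimately show "\<exists>y. DERIV h t :> y \<and> 0 \<le> y"
      by (intro exI[of _ "A * norm x / (1 + t * norm x) - x \<bullet> grad f (t *\<^sub>R x)"])
        (simp add: mult.commute)
  qed simp
  then show ?thesis
    by (simp add: h_def)
qed

text \<open>Seen from \<open>x\<close>, the ball has half-angle with sine
  \<open>r / (5/3 r) = 3/5\<close>, hence cosine 4/5; the 3-4-5 triangle keeps every constant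
  rational. The square of \<open>norm w - 4/3 * r\<close> enters because the tangents from
  \<open>x\<close> have length \<open>4/3 r\<close>.\<close>

lemma ball_in_cone:
  fixes x e y :: "'a::real_inner"
  assumes e: "norm e = 1" and r: "r > 0" and y: "y \<in> ball (x + (5 / 3 * r) *\<^sub>R e) r"
  shows "4 / 5 * norm (y - x) < (y - x) \<bullet> e"
proof -
  define w where "w = y - x"
  have "norm (w - (5 / 3 * r) *\<^sub>R e) < r"
    using y by (simp add: w_def dist_norm norm_minus_commute algebra_simps)
  then have "(norm (w - (5 / 3 * r) *\<^sub>R e))\<^sup>2 < r\<^sup>2"
    using r by (intro power_strict_mono) auto
  moreover have "(norm (w - (5 / 3 * r) *\<^sub>R e))\<^sup>2
      = (norm w)\<^sup>2 - 10 / 3 * r * (w \<bullet> e) + 25 / 9 * r\<^sup>2"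
    using e unfolding power2_norm_eq_inner norm_eq_1
    by (simp add: inner_diff_left inner_diff_right inner_commute power2_eq_square)
  moreover have "0 \<le> (norm w - 4 / 3 * r)\<^sup>2"
    by simp
  ultimately have "r * (8 / 3 * norm w) < r * (10 / 3 * (w \<bullet> e))"
    by (simp add: power2_eq_square algebra_simps)
  then show ?thesis
    using r by (simp add: w_def)
qed

section \<open>Moments and tails of subgaussian measures\<close>

text \<open>Both sides are even, and for \<open>v \<ge> 0\<close> it suffices to add
  \<open>exp v \<ge> 1 + v + v^2/2\<close> and \<open>exp (-v) \<ge> 1 - v\<close>. It bounds second
  moments by exponential moments at two opposite parameters.\<close>

lemma square_le_exp_plus_exp_minus:
  fixes u :: real
  shows "u\<^sup>2 \<le> 2 * (exp u + exp (- u) - 2)"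
proof -
  have "v\<^sup>2 \<le> 2 * (exp v + exp (- v) - 2)" if "v \<ge> 0" for v :: real
    using exp_lower_Taylor_quadratic[OF that] exp_ge_add_one_self[of "- v"] by simp
  from this[of u] this[of "- u"] show ?thesis
    by (cases "u \<ge> 0") (simp_all add: add.commute)
qed

text \<open>Squaring reduces this to e \<le> 3 \<le> 49/16.\<close>

lemma exp_half_le: "exp (1 / 2 :: real) \<le> 7 / 4"
proof (rule power2_le_imp_le)
  have "(exp (1 / 2 :: real))\<^sup>2 = exp 1"
    by (simp flip: exp_double)
  then show "(exp (1 / 2 :: real))\<^sup>2 \<le> (7 / 4)\<^sup>2"
    using exp_le by (simp add: power2_eq_square)
qed simp

text \<open>The pointwise inequality is used at \<open>u = f x / s\<close>. The exponential moments
  at \<open>1/s\<close> and \<open>-1/s\<close> are at most \<open>exp (1/2) \<le> 7/4\<close>,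
  which gives \<open>2 * (7/4 + 7/4 - 2) = 3\<close>.\<close>

lemma subgaussian_integral_square_le:
  fixes \<nu> :: "'a::euclidean_space measure"
  assumes "prob_space \<nu>" and s: "s > 0" and sub: "subgaussian \<nu> (s\<^sup>2)"
    and f: "1-lipschitz_on UNIV f" "integrable \<nu> f" "(\<integral>x. f x \<partial>\<nu>) = 0"
  shows "integrable \<nu> (\<lambda>x. (f x)\<^sup>2)" "(\<integral>x. (f x)\<^sup>2 \<partial>\<nu>) \<le> 3 * s\<^sup>2"
proof -
  interpret prob_space \<nu> by fact
  have meas[measurable]: "f \<in> borel_measurable \<nu>"
    using f(2) by simp
  have bound: "(\<integral>\<^sup>+x. ennreal (exp (l * f x)) \<partial>\<nu>) \<le> ennreal (7 / 4)" if "(s * l)\<^sup>2 = 1" for l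
  proof -
    have "(\<integral>\<^sup>+x. ennreal (exp (l * f x)) \<partial>\<nu>) \<le> ennreal (exp (s\<^sup>2 * l\<^sup>2 / 2))"
      using sub f by (auto simp: subgaussian_def)
    also have "s\<^sup>2 * l\<^sup>2 / 2 = 1 / 2"
      using that by (simp add: power_mult_distrib)
    also have "ennreal (exp (1 / 2)) \<le> ennreal (7 / 4)"
      using exp_half_le by (rule ennreal_leI)
    finally show ?thesis .
  qed
  have int: "integrable \<nu> (\<lambda>x. exp (l * f x))" and le: "(\<integral>x. exp (l * f x) \<partial>\<nu>) \<le> 7 / 4"
    if "(s * l)\<^sup>2 = 1" for l
  proof -
    show i: "integrable \<nu> (\<lambda>x. exp (l * f x))"
      using bound[OF that] by (intro integrableI_bounded) (auto simp: le_less_trans)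
    show "(\<integral>x. exp (l * f x) \<partial>\<nu>) \<le> 7 / 4"
      using bound[OF that] by (subst (asm) nn_integral_eq_integral[OF i]) auto
  qed
  have l: "(s * (1 / s))\<^sup>2 = 1" "(s * (- 1 / s))\<^sup>2 = 1"
    using s by auto
  let ?g = "\<lambda>x. 2 * s\<^sup>2 * (exp (1 / s * f x) + exp (- 1 / s * f x) - 2)"
  have g: "integrable \<nu> ?g"
    using int[OF l(1)] int[OF l(2)] by (intro integrable_mult_right integrable_diff integrable_add) auto
  have fg: "(f x)\<^sup>2 \<le> ?g x" for x
    using square_le_exp_plus_exp_minus[of "f x / s"] s
    by (simp add: power_divide field_simps)
  show i: "integrable \<nu> (\<lambda>x. (f x)\<^sup>2)"
    by (rule Bochner_Integration.integrable_bound[OF g]) (use fg in \<open>auto intro: order_trans[OF _ abs_ge_self]\<close>)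
  have "(\<integral>x. (f x)\<^sup>2 \<partial>\<nu>) \<le> (\<integral>x. ?g x \<partial>\<nu>)"
    by (rule integral_mono[OF i g fg])
  also have "\<dots> = 2 * s\<^sup>2 * ((\<integral>x. exp (1 / s * f x) \<partial>\<nu>) + (\<integral>x. exp (- 1 / s * f x) \<partial>\<nu>) - 2)"
    using int[OF l(1)] int[OF l(2)] by (simp add: prob_space)
  also have "\<dots> \<le> 2 * s\<^sup>2 * (7 / 4 + 7 / 4 - 2)"
    using le[OF l(1)] le[OF l(2)] by (intro mult_left_mono) auto
  finally show "(\<integral>x. (f x)\<^sup>2 \<partial>\<nu>) \<le> 3 * s\<^sup>2"
    by simp
qed

text \<open>The optimal constant is \<open>1\<close>; \<open>2\<close> suffices here and uses the exponential
  moments only for \<open>\<lambda> = 1/s\<close> and \<open>\<lambda> = - 1/s\<close>, not in the limit of small \<open>\<lambda>\<close>.\<close>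

lemma subgaussian_integral_norm_le:
  fixes \<nu> :: "'a::euclidean_space measure"
  assumes "prob_space \<nu>" and s: "s > 0" and sub: "subgaussian \<nu> (s\<^sup>2)"
    and int: "integrable \<nu> (\<lambda>z. z)" and centered: "(\<integral>z. z \<partial>\<nu>) = 0"
  shows "(\<integral>z. norm z \<partial>\<nu>) \<le> 2 * sqrt (real DIM('a)) * s"
proof -
  interpret prob_space \<nu> by fact
  define c where "c = sqrt (real DIM('a)) * s"
  have c: "c > 0"
    using s by (simp add: c_def)
  have c2: "c\<^sup>2 = real DIM('a) * s\<^sup>2"
    by (simp add: c_def power_mult_distrib)
  \<comment> \<open>Coordinates are 1-Lipschitz and, since \<nu> is centered, have mean
    zero.\<close>
  have coord: "integrable \<nu> (\<lambda>z. (z \<bullet> b)\<^sup>2)" "(\<integral>z. (z \<bullet> b)\<^sup>2 \<partial>\<nu>) \<le> 3 * s\<^sup>2"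
    if b: "b \<in> Basis" for b :: 'a
  proof -
    have "1-lipschitz_on UNIV (\<lambda>z. z \<bullet> b)"
      using b by (intro lipschitz_onI)
        (auto simp: dist_norm simp flip: inner_diff_left intro: Basis_le_norm)
    moreover have "(\<integral>z. z \<bullet> b \<partial>\<nu>) = 0"
      using int centered by (simp add: integral_inner_left)
    ultimately show "integrable \<nu> (\<lambda>z. (z \<bullet> b)\<^sup>2)" "(\<integral>z. (z \<bullet> b)\<^sup>2 \<partial>\<nu>) \<le> 3 * s\<^sup>2"
      using subgaussian_integral_square_le[OF assms(1-3), of "\<lambda>z. z \<bullet> b"] int by auto
  qed
  have sum: "(norm z)\<^sup>2 = (\<Sum>b\<in>Basis. (z \<bullet> b)\<^sup>2)" for z :: 'a
    by (subst power2_norm_eq_inner, subst euclidean_inner) (simp add: power2_eq_square)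
  have int2: "integrable \<nu> (\<lambda>z. (norm z)\<^sup>2)"
    unfolding sum using coord by auto
  have "(\<integral>z. (norm z)\<^sup>2 \<partial>\<nu>) = (\<Sum>b\<in>Basis. (\<integral>z. (z \<bullet> b)\<^sup>2 \<partial>\<nu>))"
    unfolding sum using coord by (intro Bochner_Integration.integral_sum) auto
  also have "\<dots> \<le> (\<Sum>b\<in>(Basis::'a set). 3 * s\<^sup>2)"
    by (intro sum_mono coord)
  also have "\<dots> = 3 * c\<^sup>2"
    by (simp add: c2)
  finally have second_moment: "(\<integral>z. (norm z)\<^sup>2 \<partial>\<nu>) \<le> 3 * c\<^sup>2" .
  \<comment> \<open>The pointwise inequality 2 c |z| \<le> |z|^2 + c^2 takes the place of
    Cauchy-Schwarz for the integral; the right side integrates to at most 4 c^2.\<close>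
  have "2 * c * (\<integral>z. norm z \<partial>\<nu>) = (\<integral>z. 2 * c * norm z \<partial>\<nu>)"
    by simp
  also have "\<dots> \<le> (\<integral>z. (norm z)\<^sup>2 + c\<^sup>2 \<partial>\<nu>)"
  proof (rule integral_mono)
    show "2 * c * norm z \<le> (norm z)\<^sup>2 + c\<^sup>2" for z :: 'a
      using sum_squares_bound[of "norm z" c] by (simp add: mult_ac)
  qed (use int int2 in auto)
  also have "\<dots> = (\<integral>z. (norm z)\<^sup>2 \<partial>\<nu>) + c\<^sup>2"
    using int2 by (simp add: prob_space)
  also have "\<dots> \<le> 2 * c * (2 * c)"
    using second_moment by (simp add: power2_eq_square)
  finally have "(\<integral>z. norm z \<partial>\<nu>) \<le> 2 * c"
    by (rule mult_left_le_imp_le) (use c in simp)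
  then show ?thesis
    by (simp add: c_def mult.assoc)
qed

text \<open>Chernoff's bound for the centered 1-Lipschitz function \<open>norm z - m\<close>; the
  parameter \<open>l = t / s^2\<close> minimizes \<open>- l * t + s^2 * l^2 / 2\<close>.\<close>

lemma subgaussian_norm_tail:
  fixes \<nu> :: "'a::euclidean_space measure"
  assumes "prob_space \<nu>" and sets: "sets \<nu> = sets borel"
    and s: "s > 0" and sub: "subgaussian \<nu> (s\<^sup>2)"
    and int: "integrable \<nu> (\<lambda>z. z)" and t: "t > 0"
  shows "emeasure \<nu> {z. (\<integral>z. norm z \<partial>\<nu>) + t \<le> norm z} \<le> ennreal (exp (- t\<^sup>2 / (2 * s\<^sup>2)))"
proof -
  interpret prob_space \<nu> by fact
  note sets[measurable_cong]
  define m where "m = (\<integral>z. norm z \<partial>\<nu>)"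
  define l where "l = t / s\<^sup>2"
  have l: "l > 0"
    using s t by (simp add: l_def)
  have "1-lipschitz_on UNIV (\<lambda>z::'a. norm z - m)"
    by (intro lipschitz_onI) (auto simp: dist_norm norm_triangle_ineq3)
  moreover have "integrable \<nu> (\<lambda>z. norm z - m)" "(\<integral>z. norm z - m \<partial>\<nu>) = 0"
    using int by (auto simp: m_def prob_space)
  ultimately have mgf: "(\<integral>\<^sup>+z. ennreal (exp (l * (norm z - m))) \<partial>\<nu>) \<le> ennreal (exp (s\<^sup>2 * l\<^sup>2 / 2))"
    using sub unfolding subgaussian_def by blast
  have "emeasure \<nu> {z. m + t \<le> norm z} = emeasure \<nu> {z \<in> UNIV. norm z - m \<ge> t}"
    by (rule arg_cong[of _ _ "emeasure \<nu>"]) auto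
  also have "\<dots> \<le> ennreal (exp (- l * t)) *
      (\<integral>\<^sup>+z. ennreal (exp (l * (norm z - m))) * indicator UNIV z \<partial>\<nu>)"
    using l by (intro Chernoff_ineq_nn_integral_ge) (auto simp: sets)
  also have "\<dots> \<le> ennreal (exp (- l * t)) * ennreal (exp (s\<^sup>2 * l\<^sup>2 / 2))"
    using mgf by (intro mult_left_mono) auto
  also have "\<dots> = ennreal (exp (- l * t + s\<^sup>2 * l\<^sup>2 / 2))"
    by (simp flip: ennreal_mult exp_add)
  also have "- l * t + s\<^sup>2 * l\<^sup>2 / 2 = - t\<^sup>2 / (2 * s\<^sup>2)"
    using s by (simp add: l_def field_simps power2_eq_square)
  finally show ?thesis
    by (simp add: m_def)
qed

section \<open>Mass of the ball and its image under the Brenier map\<close>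

text \<open>On the ball the density is at least \<open>exp (- d * b)\<close>, and
  \<open>r \<ge> 1\<close> makes its volume at least that of the unit ball. Writing this volume into
  the exponent produces the term in \<open>ln \<omega> / d\<close> of the final bound.\<close>

lemma emeasure_density_ball_ge:
  fixes V :: "'a::euclidean_space \<Rightarrow> real"
  assumes V: "V \<in> borel_measurable borel" and V_pos: "\<And>y. V y > 0" and r: "r \<ge> 1"
    and bound: "\<And>y. y \<in> ball c r \<Longrightarrow> ln (V y) \<le> b"
  shows "ennreal (exp (- real DIM('a) * (b - ln (measure lborel (ball (0::'a) 1)) / real DIM('a))))
    \<le> emeasure (density lborel (\<lambda>x. ennreal (V x powi (- int DIM('a))))) (ball c r)"
proof -
  let ?\<omega> = "measure lborel (ball (0::'a) 1)"
  let ?d = "real DIM('a)"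
  have \<omega>: "?\<omega> > 0"
    by (simp add: content_ball_pos)
  have powi: "V y powi (- int DIM('a)) = exp (- ?d * ln (V y))" for y
    using V_pos[of y] powr_real_of_int'[of "V y" "- int DIM('a)"] by (simp add: powr_def)
  have "- ?d * (b - ln ?\<omega> / ?d) = - ?d * b + ln ?\<omega>"
    by (simp add: field_simps)
  then have "ennreal (exp (- ?d * (b - ln ?\<omega> / ?d))) = ennreal (exp (- ?d * b) * ?\<omega>)"
    using \<omega> by (simp only: exp_add exp_ln)
  also have "\<dots> \<le> ennreal (exp (- ?d * b) * measure lborel (ball c r))"
    using r content_ball_conv_unit_ball[of r c] \<omega>
    by (intro ennreal_leI mult_left_mono) auto
  also have "\<dots> = ennreal (exp (- ?d * b)) * emeasure lborel (ball c r)"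
    using emeasure_lborel_ball_finite[of c r] by (simp add: ennreal_mult emeasure_eq_ennreal_measure)
  also have "\<dots> = (\<integral>\<^sup>+y. ennreal (exp (- ?d * b)) * indicator (ball c r) y \<partial>lborel)"
    by (simp add: nn_integral_cmult_indicator)
  also have "\<dots> \<le> (\<integral>\<^sup>+y. ennreal (V y powi (- int DIM('a))) * indicator (ball c r) y \<partial>lborel)"
    by (intro nn_integral_mono) (auto simp: powi indicator_def intro!: ennreal_leI bound)
  also have "\<dots> = emeasure (density lborel (\<lambda>x. ennreal (V x powi (- int DIM('a))))) (ball c r)"
    using V unfolding powi by (subst emeasure_density) auto
  finally show ?thesis .
qed

text \<open>For almost every \<open>y\<close> in the ball, the cone inequality, monotonicity of the
  gradient and Cauchy-Schwarz give 4/5 |y - x| |T x| \<le> |y - x| |T y|. The separate unit vector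
  \<open>e\<close> lets the case \<open>T x = 0\<close> be treated uniformly.\<close>

lemma brenier_map_ball_le:
  assumes brenier: "brenier_map \<mu> \<nu> S \<phi> T"
    and x: "x \<in> interior S" "\<phi> differentiable at x"
    and e: "norm e = 1" "T x = norm (T x) *\<^sub>R e" and r: "r > 0"
  shows "emeasure \<mu> (ball (x + (5 / 3 * r) *\<^sub>R e) r) \<le> emeasure \<nu> {z. 4 / 5 * norm (T x) \<le> norm z}"
proof -
  have conv: "convex_on S \<phi>"
    and ae: "AE y in \<mu>. y \<in> interior S \<and> \<phi> differentiable at y"
    and grad: "\<And>y. y \<in> interior S \<Longrightarrow> \<phi> differentiable at y \<Longrightarrow> GDERIV \<phi> y :> T y"
    and [measurable]: "T \<in> borel_measurable \<mu>" and push: "distr \<mu> borel T = \<nu>"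
    using brenier by (auto simp: brenier_map_def gderiv_grad_iff)
  let ?B = "ball (x + (5 / 3 * r) *\<^sub>R e) r"
  let ?Z = "{z. 4 / 5 * norm (T x) \<le> norm z}"
  have *: "4 / 5 * norm (T x) \<le> norm (T y)"
    if y: "y \<in> interior S" "\<phi> differentiable at y" "y \<in> ?B" for y
  proof -
    have cone: "4 / 5 * norm (y - x) < (y - x) \<bullet> e"
      using ball_in_cone[OF e(1) r y(3)] .
    \<comment> \<open>Strictness of the cone inequality excludes \<open>y = x\<close>, so
      \<open>norm (y - x)\<close> can be cancelled below.\<close>
    then have pos: "norm (y - x) > 0"
      by auto
    have "norm (y - x) * (4 / 5 * norm (T x)) \<le> norm (T x) * ((y - x) \<bullet> e)"
      using mult_left_mono[OF less_imp_le[OF cone], of "norm (T x)"] by (simp add: mult_ac)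
    also have "\<dots> = (y - x) \<bullet> T x"
      by (subst (2) e(2)) simp
    also have "\<dots> \<le> (y - x) \<bullet> T y"
      using convex_on_gderiv_monotone[OF conv] grad x y interior_subset by blast
    also have "\<dots> \<le> norm (y - x) * norm (T y)"
      by (rule norm_cauchy_schwarz)
    finally show ?thesis
      using pos by simp
  qed
  have "emeasure \<mu> ?B \<le> emeasure \<mu> (T -` ?Z \<inter> space \<mu>)"
  proof (rule emeasure_mono_AE)
    show "AE y in \<mu>. y \<in> ?B \<longrightarrow> y \<in> T -` ?Z \<inter> space \<mu>"
      using ae AE_space by eventually_elim (use * in auto)
  qed measurable
  also have "\<dots> = emeasure (distr \<mu> borel T) ?Z"
    by (rule emeasure_distr[symmetric]) measurable
  finally show ?thesis
    by (simp add: push)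
qed

section \<open>Pointwise bound on the Brenier map\<close>

theorem theorem4p1:
  fixes V :: "real ^ 'n \<Rightarrow> real"
    and \<mu> \<nu> :: "(real ^ 'n) measure"
    and S :: "(real ^ 'n) set" and \<phi> :: "real ^ 'n \<Rightarrow> real"
    and T :: "real ^ 'n \<Rightarrow> real ^ 'n"
    and A \<sigma> :: real and d :: nat
  assumes d_def: "d = CARD('n)"
    and V_pos: "\<And>x. V x > 0"
    and V_diff: "\<And>x. V differentiable at x"
    and \<mu>_def: "\<mu> = density lborel (\<lambda>x. ennreal (V x powi (- int d)))"
    and \<mu>_prob: "prob_space \<mu>"
    and A_pos: "A > 0"
    and grad_bound: "\<And>x. norm (grad (\<lambda>y. ln (V y)) x) \<le> A / (1 + norm x)"
    and \<nu>_prob: "prob_space \<nu>"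
    and \<nu>_borel: "sets \<nu> = sets borel"
    and \<nu>_int: "integrable \<nu> (\<lambda>z. z)"
    and \<nu>_centered: "(\<integral>z. z \<partial>\<nu>) = 0"
    and \<sigma>_pos: "\<sigma> > 0"
    and \<nu>_subgaussian: "subgaussian \<nu> (\<sigma>\<^sup>2)"
    and T_brenier: "brenier_map \<mu> \<nu> S \<phi> T"
  shows "\<forall>x\<in>interior S. \<phi> differentiable at x \<longrightarrow>
    norm (T x) \<le> sqrt (real d) * \<sigma> *
      (3 + 3 * sqrt (2 * A * ln 2 + 5 * A
                     - ln (measure lborel (ball (0 :: real ^ 'n) 1)) / real d
                     + ln (V 0) + 2 * A * ln (1 + norm x)))"
proof (intro ballI impI)
  fix x assume x: "x \<in> interior S" "\<phi> differentiable at x"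
  define r where "r = 1 + norm x"
  define \<omega> where "\<omega> = measure lborel (ball (0 :: real ^ 'n) 1)"
  \<comment> \<open>\<open>b\<close> will bound \<open>ln V\<close> on the ball \<open>B\<close>,
    \<open>exp (- d * L)\<close> will bound its mass from below, and \<open>K\<close> is the
    radicand of the claim.\<close>
  define b where "b = ln (V 0) + A * (ln 4 + ln r)"
  define L where "L = b - ln \<omega> / real d"
  define K where "K = 2 * A * ln 2 + 5 * A - ln \<omega> / real d + ln (V 0) + 2 * A * ln (1 + norm x)"
  define m where "m = (\<integral>z. norm z \<partial>\<nu>)"
  interpret \<mu>: prob_space \<mu> by fact
  have r: "r \<ge> 1"
    by (simp add: r_def)
  have d: "d = DIM(real ^ 'n)"
    by (simp add: d_def)
  have d_pos: "real d > 0"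
    by (simp add: d_def)

  obtain e where e: "norm e = 1" "T x = norm (T x) *\<^sub>R e"
  proof (cases "T x = 0")
    case True
    then show ?thesis
      using that[of "axis undefined 1"] by (simp add: norm_axis_1)
  next
    case False
    then show ?thesis
      using that[of "sgn (T x)"] by (simp add: norm_sgn sgn_div_norm)
  qed
  define B where "B = ball (x + (5 / 3 * r) *\<^sub>R e) r"

  have V_cont: "continuous_on UNIV V"
    using V_diff by (simp add: differentiable_imp_continuous_within continuous_on_eq_continuous_within)
  have lnV_diff: "(\<lambda>y. ln (V y)) differentiable at y" for y
    using V_diff[of y] V_pos[of y] unfolding differentiable_def
    by (auto intro!: has_derivative_ln)
  have V_bound: "ln (V y) \<le> b" if "y \<in> B" for y
  proof -
    define c where "c = x + (5 / 3 * r) *\<^sub>R e"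
    have "norm (y - c) < r"
      using that by (simp add: B_def c_def dist_norm norm_minus_commute)
    moreover have "norm y \<le> norm (y - c) + norm c"
      using norm_triangle_ineq[of "y - c" c] by simp
    moreover have "norm c \<le> norm x + 5 / 3 * r"
      using norm_triangle_ineq[of x "(5 / 3 * r) *\<^sub>R e"] e(1) r by (simp add: c_def)
    \<comment> \<open>The three estimates add up to \<open>r + 5/3 r + r = 11/3 r\<close>.\<close>
    ultimately have "1 + norm y \<le> 4 * r"
      using norm_ge_zero[of x] r_def by linarith
    then have "A * ln (1 + norm y) \<le> A * ln (4 * r)"
      using A_pos by (intro mult_left_mono) (auto intro!: ln_mono add_pos_nonneg)
    moreover have "ln (V y) \<le> ln (V 0) + A * ln (1 + norm y)"
      using lnV_diff grad_bound by (rule grad_log_growth)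
    ultimately show ?thesis
      using r by (simp add: b_def ln_mult)
  qed

  have ball_mass: "ennreal (exp (- real d * L)) \<le> emeasure \<mu> B"
    unfolding L_def \<omega>_def \<mu>_def B_def d
    by (rule emeasure_density_ball_ge)
      (use V_cont V_pos r V_bound in \<open>auto simp: B_def intro: borel_measurable_continuous_onI\<close>)
  \<comment> \<open>A lower bound for a probability cannot exceed 1. This forces
    \<open>L \<ge> 0\<close>, and with it the nonnegativity of the radicand
    \<open>K\<close>.\<close>
  then have "ennreal (exp (- real d * L)) \<le> 1"
    using \<mu>.emeasure_le_1 order_trans by blast
  then have L_nonneg: "L \<ge> 0"
    using d_pos by (simp add: zero_le_mult_iff)
  have "ln 4 = 2 * ln (2::real)"
    using ln_realpow[of 2 2] by simp
  then have "K = L + 5 * A + A * ln r"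
    by (simp add: K_def L_def b_def r_def algebra_simps)
  moreover have "0 \<le> A * ln r"
    using A_pos r by simp
  ultimately have LK: "L \<le> K"
    using A_pos by simp
  then have K_nonneg: "K \<ge> 0"
    using L_nonneg by simp

  have m: "m \<le> 2 * sqrt (real d) * \<sigma>"
    unfolding m_def d by (rule subgaussian_integral_norm_le) fact+

  \<comment> \<open>Only values above the mean \<open>m\<close> need the tail bound; there,
    comparing the exponents of the ball mass and of the Gaussian tail bounds the excess
    \<open>t\<close>.\<close>
  have "4 / 5 * norm (T x) \<le> m + sqrt (real d) * \<sigma> * sqrt (2 * K)"
  proof (cases "4 / 5 * norm (T x) \<le> m")
    case True
    then show ?thesis
      using \<sigma>_pos K_nonneg by (simp add: add_increasing2)
  next
    case False
    define t where "t = 4 / 5 * norm (T x) - m"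
    have t: "t > 0"
      using False by (simp add: t_def)
    have "ennreal (exp (- real d * L)) \<le> emeasure \<nu> {z. m + t \<le> norm z}"
      using ball_mass brenier_map_ball_le[OF T_brenier x e, of r] r
      by (simp add: B_def t_def)
    also have "\<dots> \<le> ennreal (exp (- t\<^sup>2 / (2 * \<sigma>\<^sup>2)))"
      unfolding m_def by (rule subgaussian_norm_tail) fact+
    finally have "t\<^sup>2 / (2 * \<sigma>\<^sup>2) \<le> real d * L"
      by simp
    also have "\<dots> \<le> real d * K"
      using LK d_pos by simp
    finally have "t\<^sup>2 \<le> real d * \<sigma>\<^sup>2 * (2 * K)"
      using \<sigma>_pos by (simp add: field_simps)
    then have "t \<le> sqrt (real d * \<sigma>\<^sup>2 * (2 * K))"
      by (rule real_le_rsqrt)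
    then show ?thesis
      using \<sigma>_pos by (simp add: t_def real_sqrt_mult)
  qed
  also have "\<dots> \<le> sqrt (real d) * \<sigma> * (2 + 2 * sqrt K)"
  proof -
    have "sqrt (2 * K) \<le> 2 * sqrt K"
      using K_nonneg by (intro real_le_lsqrt) (auto simp: power_mult_distrib)
    then have "sqrt (real d) * \<sigma> * sqrt (2 * K) \<le> sqrt (real d) * \<sigma> * (2 * sqrt K)"
      using \<sigma>_pos by (intro mult_left_mono) auto
    with m show ?thesis
      by (simp add: algebra_simps)
  qed
  \<comment> \<open>Undoing the factor 4/5 turns both constants 2 into 5/2, which is below
    3.\<close>
  finally have "norm (T x) \<le> sqrt (real d) * \<sigma> * (5 / 4 * (2 + 2 * sqrt K))"
    by (simp add: algebra_simps)
  also have "\<dots> \<le> sqrt (real d) * \<sigma> * (3 + 3 * sqrt K)"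
    using \<sigma>_pos K_nonneg by (intro mult_left_mono) auto
  finally show "norm (T x) \<le> sqrt (real d) * \<sigma> *
      (3 + 3 * sqrt (2 * A * ln 2 + 5 * A
                     - ln (measure lborel (ball (0 :: real ^ 'n) 1)) / real d
                     + ln (V 0) + 2 * A * ln (1 + norm x)))"
    by (simp add: K_def \<omega>_def)
qed

end
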